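(* Let $\mathfrak g$ be a simple Lie algebra with a short grading $\mathfrak g=\mathfrak g(-1)\oplus\mathfrak g(0)\oplus\mathfrak g(1)$ such that $\mathfrak g(0)^e$ is reductive, where $e$ lies in the dense $G(0)$-orbit in $\mathfrak g(1)$, and consider the corresponding Jordan triad. The commuting variety $\{(x,y)\in\mathfrak g(-1)\times\mathfrak g(-1)\mid x\circ y=0\}$ of the Jordan algebra $\{\mathfrak g(-1),\circ\}$, where $x\circ y=[x,[e,y]]$, is isomorphic to the zero fibre of the commutator mapping $$\varphi:\mathfrak g_{10}\times\mathfrak g_{11}=[\mathfrak m,e-f]\times[\mathfrak m,e+f]\to\mathfrak m=\mathfrak g_{01},\qquad \varphi(u,v)=[u,v].$$
   Context: The ground field is algebraically closed of characteristic $0$; $G$ is a connected algebraic group with simple Lie algebra $\mathfrak g$. A short grading is a $\mathbb Z$-grading $\mathfrak g=\mathfrak g(-1)\oplus\mathfrak g(0)\oplus\mathfrak g(1)$ with three nonzero terms. There is a unique $h\in\mathfrak g(0)$ with $\mathfrak g(i)=\{x\in\mathfrak g\mid[h,x]=2ix\}$. $G(0)$ is the connected subgroup of $G$ with Lie algebra $\mathfrak g(0)$; it has a dense orbit in $\mathfrak g(1)$, and $e$ is an element of it. $\mathfrak g(0)^e$ is the centraliser of $e$ in $\mathfrak g(0)$; "reductive" means that the stabiliser of $e$ in $G(0)$ is a reductive group. In this case there is a unique $f\in\mathfrak g(-1)$ with $[e,f]=h$, and $\{e,h,f\}$ is an $\mathfrak{sl}_2$-triple. Put $\mathfrak k=\mathfrak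 g(0)^e$ and $\mathfrak m=[e,\mathfrak g(-1)]$; then $\mathfrak g(0)=\mathfrak k\oplus\mathfrak m$, and $\{\mathfrak g(-1),\circ\}$ with $x\circ y=[x,[e,y]]$ is a simple Jordan algebra. The Jordan triad $\{\sigma_1,\sigma_2,\sigma_3\}$ consists of: $\sigma_1$, equal to $+1$ on $\mathfrak g(0)$ and $-1$ on $\mathfrak g(-1)\oplus\mathfrak g(1)$; $\sigma_2$, the involution of $\mathfrak g$ equal to $+1$ on $\mathfrak k$, $-1$ on $\mathfrak m$, interchanging $e$ and $f$ and satisfying $\sigma_2([x,e])=-[x,f]$ for $x\in\mathfrak m$; and $\sigma_3=\sigma_1\sigma_2$. With $\mathfrak g_{ij}=\{x\in\mathfrak g\mid\sigma_1(x)=(-1)^i x,\ \sigma_2(x)=(-1)^j x\}$ one has $\mathfrak g_{00}=\mathfrak k$, $\mathfrak g_{01}=\mathfrak m$, $\mathfrak g_{10}=[\mathfrak m,e-f]$, $\mathfrak g_{11}=[\mathfrak m,e+f]$. *)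

theory Defs
  imports
    "HOL-Analysis.Analysis"
    "HOL-Algebra.Coset"
    "HOL-Computational_Algebra.Polynomial"
begin

section \<open>Affine varieties inside finite-dimensional vector spaces\<close>

text \<open>Polynomial functions on a vector space, coordinate-free: the algebra of functions generated
  by the linear forms.  Over an infinite field polynomials and polynomial functions agree.\<close>

inductive_set polyfun :: "('k::field \<Rightarrow> 'v::ab_group_add \<Rightarrow> 'v) \<Rightarrow> ('v \<Rightarrow> 'k) set"
  for s :: "'k::field \<Rightarrow> 'v::ab_group_add \<Rightarrow> 'v" where
  const: "(\<lambda>_. c) \<in> polyfun s"
| form: "Vector_Spaces.linear s (*) p \<Longrightarrow> p \<in> polyfun s"
| add: "\<lbrakk>p \<in> polyfun s; q \<in> polyfun s\<rbrakk> \<Longrightarrow> (\<lambda>x. p x + q x) \<in> polyfun s"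
| mult: "\<lbrakk>p \<in> polyfun s; q \<in> polyfun s\<rbrakk> \<Longrightarrow> (\<lambda>x. p x * q x) \<in> polyfun s"

definition zariski :: "('k::field \<Rightarrow> 'v::ab_group_add \<Rightarrow> 'v) \<Rightarrow> 'v topology" where
  "zariski s = topology_generated_by {{x. p x \<noteq> 0} | p. p \<in> polyfun s}"

text \<open>For a Zariski closed \<open>X\<close> these are the regular functions on \<open>X\<close>; two functions that agree
  on \<open>X\<close> are not distinguished.\<close>

definition regular_on ::
  "('k::field \<Rightarrow> 'v::ab_group_add \<Rightarrow> 'v) \<Rightarrow> 'v set \<Rightarrow> ('v \<Rightarrow> 'k) \<Rightarrow> bool" where
  "regular_on s X r \<longleftrightarrow> (\<exists>p\<in>polyfun s. \<forall>x\<in>X. r x = p x)"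

definition affine_morphism ::
  "('k::field \<Rightarrow> 'v::ab_group_add \<Rightarrow> 'v) \<Rightarrow> ('k \<Rightarrow> 'w::ab_group_add \<Rightarrow> 'w) \<Rightarrow>
   'v set \<Rightarrow> 'w set \<Rightarrow> ('v \<Rightarrow> 'w) \<Rightarrow> bool" where
  "affine_morphism s1 s2 X Y F \<longleftrightarrow>
     F \<in> X \<rightarrow> Y \<and> (\<forall>r. regular_on s2 Y r \<longrightarrow> regular_on s1 X (r \<circ> F))"

definition isomorphic_varieties ::
  "('k::field \<Rightarrow> 'v::ab_group_add \<Rightarrow> 'v) \<Rightarrow> ('k \<Rightarrow> 'w::ab_group_add \<Rightarrow> 'w) \<Rightarrow>
   'v set \<Rightarrow> 'w set \<Rightarrow> bool" where
  "isomorphic_varieties s1 s2 X Y \<longleftrightarrow>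
     closedin (zariski s1) X \<and> closedin (zariski s2) Y \<and>
     (\<exists>F H. affine_morphism s1 s2 X Y F \<and> affine_morphism s2 s1 Y X H \<and>
            (\<forall>x\<in>X. H (F x) = x) \<and> (\<forall>y\<in>Y. F (H y) = y))"


section \<open>Linear algebraic groups\<close>

definition mat_scale :: "'k::field \<Rightarrow> 'k^'n^'n \<Rightarrow> 'k^'n^'n" where
  "mat_scale c = map_matrix ((*) c)"

definition GL :: "('k::field^'n^'n) monoid" where
  "GL = \<lparr>carrier = {A. invertible A}, mult = (**), one = mat 1\<rparr>"

text \<open>The topology of \<open>GL\<close> as an affine variety (with \<open>1/det\<close> regular) is the one
  induced from the space of all matrices.\<close>

definition algebraic_group :: "('k::field^'n^'n) set \<Rightarrow> bool" where
  "algebraic_group H \<longleftrightarrow>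
     subgroup H GL \<and> closedin (subtopology (zariski mat_scale) (carrier GL)) H"

definition connected_algebraic_group :: "('k::field^'n^'n) set \<Rightarrow> bool" where
  "connected_algebraic_group H \<longleftrightarrow> algebraic_group H \<and> connectedin (zariski mat_scale) H"

text \<open>The derivative at \<open>a\<close> in direction \<open>v\<close>: the coefficient of \<open>t\<close> in the
  polynomial \<open>p (a + t v)\<close>, which is unique over an infinite field.\<close>

definition dir_deriv ::
  "('k::field_char_0 \<Rightarrow> 'v::ab_group_add \<Rightarrow> 'v) \<Rightarrow> ('v \<Rightarrow> 'k) \<Rightarrow> 'v \<Rightarrow> 'v \<Rightarrow> 'k" where
  "dir_deriv s p a v = poly (pderiv (THE q. \<forall>t. poly q t = p (a + s t v))) 0"

text \<open>The tangent space of \<open>H\<close> at the identity.\<close>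

definition Lie :: "('k::field_char_0^'n^'n) set \<Rightarrow> ('k^'n^'n) set" where
  "Lie H = {X. \<forall>p\<in>polyfun mat_scale. (\<forall>A\<in>H. p A = 0) \<longrightarrow> dir_deriv mat_scale p (mat 1) X = 0}"

text \<open>The power is iterated \<open>**\<close>; the library's \<open>^\<close> on vectors would be componentwise.\<close>

definition unipotent :: "'k::field^'n^'n \<Rightarrow> bool" where
  "unipotent A \<longleftrightarrow> (\<exists>N::nat. (((**) (A - mat 1)) ^^ N) (mat 1) = 0)"

text \<open>\<open>H\<close> need not be connected.  Its unipotent radical is the largest connected normal
  unipotent closed subgroup, so this says that the unipotent radical is trivial.\<close>

definition reductive_group :: "('k::field^'n^'n) set \<Rightarrow> bool" where
  "reductive_group H \<longleftrightarrow> algebraic_group H \<and>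
     (\<forall>N. connected_algebraic_group N \<and> N \<lhd> (GL\<lparr>carrier := H\<rparr>) \<and> (\<forall>A\<in>N. unipotent A)
          \<longrightarrow> N = {mat 1})"


section \<open>Lie algebras, gradings and involutions\<close>

locale lie_algebra = vector_space s
  for s :: "'k::field \<Rightarrow> 'g::ab_group_add \<Rightarrow> 'g" +
  fixes br :: "'g \<Rightarrow> 'g \<Rightarrow> 'g"
  assumes linear_left: "Vector_Spaces.linear s s (\<lambda>x. br x y)"
    and linear_right: "Vector_Spaces.linear s s (\<lambda>y. br x y)"
    and alternating: "br x x = 0"
    and jacobi: "br x (br y z) + br y (br z x) + br z (br x y) = 0"

definition lie_ideal ::
  "('k::field \<Rightarrow> 'g::ab_group_add \<Rightarrow> 'g) \<Rightarrow> ('g \<Rightarrow> 'g \<Rightarrow> 'g) \<Rightarrow> 'g set \<Rightarrow> bool" where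
  "lie_ideal s br I \<longleftrightarrow> module.subspace s I \<and> (\<forall>x. \<forall>y\<in>I. br x y \<in> I)"

definition simple_lie_algebra ::
  "('k::field \<Rightarrow> 'g::ab_group_add \<Rightarrow> 'g) \<Rightarrow> ('g \<Rightarrow> 'g \<Rightarrow> 'g) \<Rightarrow> bool" where
  "simple_lie_algebra s br \<longleftrightarrow>
     lie_algebra s br \<and> (\<exists>B. finite_dimensional_vector_space s B) \<and>
     (\<exists>x y. br x y \<noteq> 0) \<and> (\<forall>I. lie_ideal s br I \<longrightarrow> I = {0} \<or> I = UNIV)"

text \<open>An identification \<open>\<theta>\<close> of \<open>\<gg>\<close> with the Lie algebra of \<open>G\<close>.\<close>

definition lie_algebra_of_group ::
  "('k::field_char_0 \<Rightarrow> 'g::ab_group_add \<Rightarrow> 'g) \<Rightarrow> ('g \<Rightarrow> 'g \<Rightarrow> 'g) \<Rightarrow>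
   ('k^'n^'n) set \<Rightarrow> ('g \<Rightarrow> 'k^'n^'n) \<Rightarrow> bool" where
  "lie_algebra_of_group s br G \<theta> \<longleftrightarrow>
     Vector_Spaces.linear s mat_scale \<theta> \<and> bij_betw \<theta> UNIV (Lie G) \<and>
     (\<forall>x y. \<theta> (br x y) = \<theta> x ** \<theta> y - \<theta> y ** \<theta> x)"

text \<open>The adjoint action, transported to \<open>\<gg>\<close>; only used for \<open>A \<in> G\<close>, which normalises the
  range of \<open>\<theta>\<close>.\<close>

definition Ad :: "('g \<Rightarrow> 'k::field^'n^'n) \<Rightarrow> 'k^'n^'n \<Rightarrow> 'g \<Rightarrow> 'g" where
  "Ad \<theta> A x = the_inv \<theta> (A ** \<theta> x ** matrix_inv A)"

definition Z_grading ::
  "('k::field \<Rightarrow> 'g::ab_group_add \<Rightarrow> 'g) \<Rightarrow> ('g \<Rightarrow> 'g \<Rightarrow> 'g) \<Rightarrow> (int \<Rightarrow> 'g set) \<Rightarrow> bool" where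
  "Z_grading s br gr \<longleftrightarrow>
     (\<forall>i. module.subspace s (gr i)) \<and>
     (\<forall>x. \<exists>!c. (\<forall>i. c i \<in> gr i) \<and> finite {i. c i \<noteq> 0} \<and> x = (\<Sum>i | c i \<noteq> 0. c i)) \<and>
     (\<forall>i j. \<forall>x\<in>gr i. \<forall>y\<in>gr j. br x y \<in> gr (i + j))"

definition short_grading ::
  "('k::field \<Rightarrow> 'g::ab_group_add \<Rightarrow> 'g) \<Rightarrow> ('g \<Rightarrow> 'g \<Rightarrow> 'g) \<Rightarrow> (int \<Rightarrow> 'g set) \<Rightarrow> bool" where
  "short_grading s br gr \<longleftrightarrow>
     Z_grading s br gr \<and> (\<forall>i. gr i \<noteq> {0} \<longleftrightarrow> i \<in> {-1, 0, 1})"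

definition grading_element ::
  "('k::field \<Rightarrow> 'g::ab_group_add \<Rightarrow> 'g) \<Rightarrow> ('g \<Rightarrow> 'g \<Rightarrow> 'g) \<Rightarrow> (int \<Rightarrow> 'g set) \<Rightarrow> 'g \<Rightarrow> bool" where
  "grading_element s br gr h \<longleftrightarrow>
     h \<in> gr 0 \<and> (\<forall>i. gr i = {x. br h x = s (of_int (2 * i)) x})"

text \<open>\<open>\<kk> = \<gg>(0)\<^sup>e\<close> and \<open>\<mm> = [e, \<gg>(-1)]\<close>.\<close>

definition \<kk> :: "('g::ab_group_add \<Rightarrow> 'g \<Rightarrow> 'g) \<Rightarrow> (int \<Rightarrow> 'g set) \<Rightarrow> 'g \<Rightarrow> 'g set" where
  "\<kk> br gr e = {x \<in> gr 0. br e x = 0}"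

definition \<mm> :: "('g::ab_group_add \<Rightarrow> 'g \<Rightarrow> 'g) \<Rightarrow> (int \<Rightarrow> 'g set) \<Rightarrow> 'g \<Rightarrow> 'g set" where
  "\<mm> br gr e = br e ` gr (-1)"

definition lie_involution ::
  "('k::field \<Rightarrow> 'g::ab_group_add \<Rightarrow> 'g) \<Rightarrow> ('g \<Rightarrow> 'g \<Rightarrow> 'g) \<Rightarrow> ('g \<Rightarrow> 'g) \<Rightarrow> bool" where
  "lie_involution s br \<sigma> \<longleftrightarrow>
     Vector_Spaces.linear s s \<sigma> \<and> (\<forall>x y. \<sigma> (br x y) = br (\<sigma> x) (\<sigma> y)) \<and>
     \<sigma> \<circ> \<sigma> = id \<and> \<sigma> \<noteq> id"

text \<open>Since \<open>\<gg> = \<kk> \<oplus> \<mm> \<oplus> [\<mm>, e] \<oplus> [\<mm>, f]\<close>, the conditions determine the three maps.\<close>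

definition jordan_triad ::
  "('k::field \<Rightarrow> 'g::ab_group_add \<Rightarrow> 'g) \<Rightarrow> ('g \<Rightarrow> 'g \<Rightarrow> 'g) \<Rightarrow> (int \<Rightarrow> 'g set) \<Rightarrow> 'g \<Rightarrow> 'g \<Rightarrow>
   ('g \<Rightarrow> 'g) \<Rightarrow> ('g \<Rightarrow> 'g) \<Rightarrow> ('g \<Rightarrow> 'g) \<Rightarrow> bool" where
  "jordan_triad s br gr e f \<sigma>1 \<sigma>2 \<sigma>3 \<longleftrightarrow>
     lie_involution s br \<sigma>1 \<and>
     (\<forall>x\<in>gr 0. \<sigma>1 x = x) \<and> (\<forall>x\<in>gr (-1) \<union> gr 1. \<sigma>1 x = - x) \<and>
     lie_involution s br \<sigma>2 \<and>
     (\<forall>x\<in>\<kk> br gr e. \<sigma>2 x = x) \<and> (\<forall>x\<in>\<mm> br gr e. \<sigma>2 x = - x) \<and>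
     \<sigma>2 e = f \<and> \<sigma>2 f = e \<and> (\<forall>x\<in>\<mm> br gr e. \<sigma>2 (br x e) = - br x f) \<and>
     \<sigma>3 = \<sigma>1 \<circ> \<sigma>2"

definition joint_eigenspace ::
  "('k::field \<Rightarrow> 'g::ab_group_add \<Rightarrow> 'g) \<Rightarrow> ('g \<Rightarrow> 'g) \<Rightarrow> ('g \<Rightarrow> 'g) \<Rightarrow> nat \<Rightarrow> nat \<Rightarrow> 'g set" where
  "joint_eigenspace s \<sigma>1 \<sigma>2 i j =
     {x. \<sigma>1 x = s ((-1) ^ i) x \<and> \<sigma>2 x = s ((-1) ^ j) x}"

definition jordan_product :: "('g \<Rightarrow> 'g \<Rightarrow> 'g) \<Rightarrow> 'g \<Rightarrow> 'g \<Rightarrow> 'g \<Rightarrow> 'g" where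
  "jordan_product br e x y = br x (br e y)"

definition jordan_commuting_variety ::
  "('g::ab_group_add \<Rightarrow> 'g \<Rightarrow> 'g) \<Rightarrow> (int \<Rightarrow> 'g set) \<Rightarrow> 'g \<Rightarrow> ('g \<times> 'g) set" where
  "jordan_commuting_variety br gr e =
     {(x, y) \<in> gr (-1) \<times> gr (-1). jordan_product br e x y = 0}"

end

theory Submission
  imports Defs
begin

text \<open>Since \<open>ad e\<close> is injective on \<open>\<gg>(-1)\<close> and \<open>\<mm> = [e, \<gg>(-1)]\<close>, every element of \<open>\<mm>\<close> is \<open>[e, a]\<close> for
  exactly one \<open>a \<in> \<gg>(-1)\<close>.  So once \<open>\<gg>\<^sub>1\<^sub>0 = [\<mm>, e - f]\<close> and \<open>\<gg>\<^sub>1\<^sub>1 = [\<mm>, e + f]\<close> are known, the linear map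
  \<open>(a, b) \<mapsto> ([[e, a], e - f], [[e, b], e + f])\<close> sends \<open>\<gg>(-1) \<times> \<gg>(-1)\<close> onto \<open>\<gg>\<^sub>1\<^sub>0 \<times> \<gg>\<^sub>1\<^sub>1\<close>.  It carries
  the Jordan product to the commutator:
  \<open>[[[e, a], e - f], [[e, b], e + f]] = -4 [e, a \<circ> b]\<close> (lemma \<open>commutator_eq_jordan_product\<close>).
  Indeed \<open>[[e, a], e - f] = 2a - [e, [e, a]]\<close> and \<open>[[e, b], e + f] = -2b - [e, [e, b]]\<close>; in the bracket
  of these two elements the terms in \<open>\<gg>(-2)\<close> and \<open>\<gg>(2)\<close> vanish, and the remaining ones are
  \<open>-2 ([a, [e, [e, b]]] + [b, [e, [e, a]]])\<close>, which is \<open>-4 [e, a \<circ> b]\<close> because \<open>\<circ>\<close> is commutative and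
  \<open>ad e\<close> is a derivation.  As \<open>a \<circ> b \<in> \<gg>(-1)\<close>, the commutator vanishes exactly when \<open>a \<circ> b\<close> does.
  The inverse is \<open>(u, v) \<mapsto> ([f, [e, u]] / 4, - [f, [e, v]] / 4)\<close>, so both directions are restrictions
  of linear maps, and these are morphisms.

  The eigenspaces come from the \<open>\<ss>\<ll>\<^sub>2\<close>-triple \<open>e, h, f\<close>: it gives \<open>\<gg>(0) = \<kk> + \<mm>\<close>, \<open>\<gg>(1) = [\<mm>, e]\<close> and
  \<open>\<gg>(-1) = [\<mm>, f]\<close>, and \<open>\<sigma>\<^sub>2\<close> acts on \<open>[y, e] + [y', f]\<close>, for \<open>y, y' \<in> \<mm>\<close>, by replacing
  the pair \<open>(y, y')\<close> with \<open>(-y', -y)\<close>.\<close>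

section \<open>Polynomial maps\<close>

text \<open>Testing against linear forms replaces coordinates, so that no basis of either space is
  chosen.\<close>

definition polynomial_map ::
  "('k::field \<Rightarrow> 'v::ab_group_add \<Rightarrow> 'v) \<Rightarrow> ('k \<Rightarrow> 'w::ab_group_add \<Rightarrow> 'w) \<Rightarrow> ('v \<Rightarrow> 'w) \<Rightarrow> bool" where
  "polynomial_map s1 s2 F \<longleftrightarrow> (\<forall>p. Vector_Spaces.linear s2 (*) p \<longrightarrow> p \<circ> F \<in> polyfun s1)"

lemma polyfun_comp_polynomial_map:
  assumes "p \<in> polyfun s2" and "polynomial_map s1 s2 F"
  shows "p \<circ> F \<in> polyfun s1"
  using assms
proof (induction rule: polyfun.induct)
  case (const c)
  show ?case using polyfun.const[of c s1] by (simp add: comp_def)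
next
  case (form p)
  then show ?case unfolding polynomial_map_def by blast
next
  case (add p q)
  then show ?case using polyfun.add[of "p \<circ> F" s1 "q \<circ> F"] by (simp add: comp_def)
next
  case (mult p q)
  then show ?case using polyfun.mult[of "p \<circ> F" s1 "q \<circ> F"] by (simp add: comp_def)
qed

lemma linear_polynomial_map:
  assumes "Vector_Spaces.linear s1 s2 F"
  shows "polynomial_map s1 s2 F"
  using assms unfolding polynomial_map_def
  by (blast intro: polyfun.form Vector_Spaces.linear_compose)

lemma polynomial_map_affine_morphism:
  assumes "polynomial_map s1 s2 F" and "F \<in> X \<rightarrow> Y"
  shows "affine_morphism s1 s2 X Y F"
  unfolding affine_morphism_def regular_on_def
proof (intro conjI allI impI)
  fix r assume "\<exists>p\<in>polyfun s2. \<forall>x\<in>Y. r x = p x"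
  then obtain p where "p \<in> polyfun s2" "\<forall>x\<in>Y. r x = p x" by blast
  then show "\<exists>q\<in>polyfun s1. \<forall>x\<in>X. (r \<circ> F) x = q x"
    using assms polyfun_comp_polynomial_map[of p s2 s1 F]
    by (intro bexI[of _ "p \<circ> F"]) auto
qed fact

lemma polyfun_sum:
  assumes "finite A" and "\<And>a. a \<in> A \<Longrightarrow> p a \<in> polyfun s"
  shows "(\<lambda>x. \<Sum>a\<in>A. p a x) \<in> polyfun s"
  using assms
proof (induction A)
  case empty
  show ?case using polyfun.const[of 0 s] by simp
next
  case (insert a A)
  have "p a \<in> polyfun s" "(\<lambda>x. \<Sum>a\<in>A. p a x) \<in> polyfun s" using insert by blast+
  then show ?case unfolding sum.insert[OF insert.hyps(1,2)] by (rule polyfun.add)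
qed

lemma closedin_zariski_zeros:
  fixes s :: "'k::field \<Rightarrow> 'v::ab_group_add \<Rightarrow> 'v"
  assumes "P \<subseteq> polyfun s"
  shows "closedin (zariski s) {x. \<forall>p\<in>P. p x = 0}"
proof -
  (* The constant 1 shows that the generating sets cover the space. *)
  let ?Z = "{{x. p x \<noteq> 0} | p. p \<in> polyfun s}"
  have "{x. (\<lambda>_. 1::'k) x \<noteq> 0} \<in> ?Z"
    by (rule CollectI, rule exI, rule conjI, rule refl, rule polyfun.const)
  then have "UNIV \<in> ?Z" by simp
  then have top: "topspace (zariski s) = UNIV"
    unfolding zariski_def topology_generated_by_topspace by (rule top.extremum_uniqueI[OF Union_upper])
  have "openin (zariski s) {x. p x \<noteq> 0}" if "p \<in> P" for p
    unfolding zariski_def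
  proof (rule topology_generated_by_Basis)
    show "{x. p x \<noteq> 0} \<in> ?Z" using assms that by blast
  qed
  then have "openin (zariski s) (\<Union>p\<in>P. {x. p x \<noteq> 0})" by blast
  moreover have "(\<Union>p\<in>P. {x. p x \<noteq> 0}) = UNIV - {x. \<forall>p\<in>P. p x = 0}" by auto
  ultimately show ?thesis by (simp add: closedin_def top)
qed

text \<open>In finite dimension the coordinate forms separate points, so a vector-valued equation is the
  system of the polynomial equations given by all linear forms.\<close>

lemma closedin_polynomial_map_zeros:
  assumes "finite_dimensional_vector_space s2 B" and F: "polynomial_map s1 s2 F"
  shows "closedin (zariski s1) {x. F x = 0}"
proof -
  interpret finite_dimensional_vector_space s2 B by fact
  let ?P = "{p \<circ> F | p. Vector_Spaces.linear s2 (*) p}"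
  have form: "Vector_Spaces.linear s2 (*) (\<lambda>v. representation B v b)" for b
    by (rule linear_representation[OF independent_Basis span_Basis])
  have "F x = 0" if "\<forall>q\<in>?P. q x = 0" for x
  proof -
    have "representation B (F x) b = 0" for b
    proof -
      have "(\<lambda>v. representation B v b) \<circ> F \<in> ?P" using form by blast
      from bspec[OF that this] show ?thesis by (simp only: comp_def)
    qed
    then have "(\<Sum>b\<in>B. s2 (representation B (F x) b) b) = 0" by simp
    moreover have "(\<Sum>b\<in>B. s2 (representation B (F x) b) b) = F x"
      using independent_Basis span_Basis finite_Basis by (intro sum_representation_eq) auto
    ultimately show ?thesis by (rule trans[OF sym, rotated])
  qed
  moreover have "q x = 0" if "F x = 0" and q: "q \<in> ?P" for q x
  proof -
    obtain p where p: "Vector_Spaces.linear s2 (*) p" "q = p \<circ> F" using q by blast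
    interpret p: Vector_Spaces.linear s2 "(*)" p by fact
    show ?thesis using \<open>F x = 0\<close> by (simp add: p(2) p.zero)
  qed
  ultimately have "{x. F x = 0} = {x. \<forall>q\<in>?P. q x = 0}" by blast
  moreover have "?P \<subseteq> polyfun s1" using F by (auto simp: polynomial_map_def)
  ultimately show ?thesis using closedin_zariski_zeros[of ?P s1] by (simp only:)
qed

text \<open>Expanding only the first argument in the basis is enough: it makes each form of the value
  a finite sum of products of a coordinate of \<open>u\<close> and a linear form in \<open>v\<close>.\<close>

lemma bilinear_polynomial_map:
  assumes "finite_dimensional_vector_space s B"
    and left: "\<And>y. Vector_Spaces.linear s t (\<lambda>x. \<beta> x y)"
    and right: "\<And>x. Vector_Spaces.linear s t (\<beta> x)"
  shows "polynomial_map (module_prod.scale s s) t (\<lambda>z. \<beta> (fst z) (snd z))"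
  unfolding polynomial_map_def
proof (intro allI impI)
  fix p assume p: "Vector_Spaces.linear t (*) p"
  interpret finite_dimensional_vector_space s B by fact
  interpret pr: vector_space_prod s s ..
  have expand: "p (\<beta> u v) = (\<Sum>c\<in>B. representation B u c * p (\<beta> c v))" for u v
  proof -
    have "Vector_Spaces.linear s (*) (p \<circ> (\<lambda>x. \<beta> x v))"
      by (rule Vector_Spaces.linear_compose[OF left p])
    then interpret q: Vector_Spaces.linear s "(*)" "p \<circ> (\<lambda>x. \<beta> x v)" .
    have "(\<Sum>c\<in>B. s (representation B u c) c) = u"
      using independent_Basis span_Basis finite_Basis by (intro sum_representation_eq) auto
    then have "p (\<beta> u v) = (p \<circ> (\<lambda>x. \<beta> x v)) (\<Sum>c\<in>B. s (representation B u c) c)"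
      by (simp only: comp_def)
    then show ?thesis unfolding q.sum q.scale by simp
  qed
  have "p \<circ> (\<lambda>z. \<beta> (fst z) (snd z))
      = (\<lambda>z. \<Sum>c\<in>B. representation B (fst z) c * p (\<beta> c (snd z)))"
    unfolding comp_def by (intro ext expand)
  also have "\<dots> \<in> polyfun pr.scale"
  proof (intro polyfun_sum polyfun.mult)
    fix c
    have "Vector_Spaces.linear s (*) (\<lambda>v. representation B v c)"
      by (rule linear_representation[OF independent_Basis span_Basis])
    from Vector_Spaces.linear_compose[OF pr.linear_fst this]
    show "(\<lambda>z. representation B (fst z) c) \<in> polyfun pr.scale"
      by (auto intro: polyfun.form simp: comp_def)
    have "Vector_Spaces.linear pr.scale (*) (p \<circ> (\<beta> c \<circ> snd))"
      by (intro Vector_Spaces.linear_compose[OF _ p] Vector_Spaces.linear_compose[OF pr.linear_snd right])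
    then show "(\<lambda>z. p (\<beta> c (snd z))) \<in> polyfun pr.scale"
      by (auto intro: polyfun.form simp: comp_def)
  qed (rule finite_Basis)
  finally show "p \<circ> (\<lambda>z. \<beta> (fst z) (snd z)) \<in> polyfun pr.scale" .
qed

text \<open>The pieces \<open>\<gg>(i)\<close> and the joint eigenspaces of the involutions are cut out by such
  equations.\<close>

lemma closedin_eigenspace_factor:
  assumes fd: "finite_dimensional_vector_space s B" and g: "Vector_Spaces.linear s s g"
  shows "closedin (zariski (module_prod.scale s s)) {z. g (fst z) = s c (fst z)}"
    and "closedin (zariski (module_prod.scale s s)) {z. g (snd z) = s c (snd z)}"
proof -
  interpret finite_dimensional_vector_space s B by fact
  interpret pr: vector_space_prod s s ..
  have "Vector_Spaces.linear s s (\<lambda>x. g x - s c x)"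
    by (intro pr.linear_compose_sub g linear_scale_self)
  note poly = linear_polynomial_map[OF Vector_Spaces.linear_compose[OF _ this]]
  show "closedin (zariski pr.scale) {z. g (fst z) = s c (fst z)}"
    using closedin_polynomial_map_zeros[OF fd poly[OF pr.linear_fst]]
    by (simp only: comp_def right_minus_eq)
  show "closedin (zariski pr.scale) {z. g (snd z) = s c (snd z)}"
    using closedin_polynomial_map_zeros[OF fd poly[OF pr.linear_snd]]
    by (simp only: comp_def right_minus_eq)
qed

section \<open>Short gradings given by an \<open>\<ss>\<ll>\<^sub>2\<close>-triple\<close>

context lie_algebra
begin

lemma br_add_left: "br (x + y) z = br x z + br y z"
  and br_diff_left: "br (x - y) z = br x z - br y z"
  and br_minus_left: "br (- x) z = - br x z"
  and br_scale_left: "br (s c x) z = s c (br x z)"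
  and br_zero_left: "br 0 z = 0"
proof -
  interpret l: Vector_Spaces.linear s s "\<lambda>x. br x z" by (rule linear_left)
  show "br (x + y) z = br x z + br y z" "br (x - y) z = br x z - br y z"
    "br (- x) z = - br x z" "br (s c x) z = s c (br x z)" "br 0 z = 0"
    using l.add l.diff l.neg l.scale l.zero by auto
qed

lemma br_add_right: "br z (x + y) = br z x + br z y"
  and br_diff_right: "br z (x - y) = br z x - br z y"
  and br_minus_right: "br z (- x) = - br z x"
  and br_scale_right: "br z (s c x) = s c (br z x)"
  and br_zero_right: "br z 0 = 0"
proof -
  interpret r: Vector_Spaces.linear s s "br z" using linear_right by simp
  show "br z (x + y) = br z x + br z y" "br z (x - y) = br z x - br z y"
    "br z (- x) = - br z x" "br z (s c x) = s c (br z x)" "br z 0 = 0"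
    using r.add r.diff r.neg r.scale r.zero by auto
qed

lemmas br_bilinear = br_add_left br_diff_left br_minus_left br_scale_left br_zero_left
  br_add_right br_diff_right br_minus_right br_scale_right br_zero_right

lemma br_skew: "br x y = - br y x"
proof -
  have "br (x + y) (x + y) = 0" "br x x = 0" "br y y = 0" by (rule alternating)+
  then have "br x y + br y x = 0" by (simp add: br_bilinear add.commute)
  then show ?thesis by (simp add: eq_neg_iff_add_eq_0)
qed

lemma br_leibniz: "br x (br y z) = br (br x y) z + br y (br x z)"
proof -
  have "br x (br y z) - br y (br x z) - br (br x y) z = 0"
    using jacobi[of x y z] br_skew[of y "br z x"] br_skew[of "br z x" y] br_skew[of z x]
      br_skew[of z "br x y"]
    by (simp add: br_bilinear algebra_simps)
  then show ?thesis by (simp add: algebra_simps)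
qed

end

locale short_graded_sl2 = lie_algebra s br
  for s :: "'k::field_char_0 \<Rightarrow> 'g::ab_group_add \<Rightarrow> 'g" and br :: "'g \<Rightarrow> 'g \<Rightarrow> 'g" +
  fixes gr :: "int \<Rightarrow> 'g set" and e f :: 'g
  assumes short: "short_grading s br gr"
    and e_gr: "e \<in> gr 1" and f_gr: "f \<in> gr (-1)"
    and h_grading: "grading_element s br gr (br e f)"
begin

lemma br_gr: "x \<in> gr i \<Longrightarrow> y \<in> gr j \<Longrightarrow> i + j = l \<Longrightarrow> br x y \<in> gr l"
  using short by (auto simp: short_grading_def Z_grading_def)

lemma gr_subspace: "subspace (gr i)"
  using short by (auto simp: short_grading_def Z_grading_def)

lemma gr_trivial: "x \<in> gr i \<Longrightarrow> i \<notin> {-1, 0, 1} \<Longrightarrow> x = 0"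
  using short by (auto simp: short_grading_def)

lemma h_gr: "x \<in> gr i \<Longrightarrow> br (br e f) x = s (of_int (2 * i)) x"
  using h_grading by (auto simp: grading_element_def)

lemma scale_two: "s 2 x = x + x"
  using scale_left_distrib[of 1 1 x] by simp

lemma scale_four: "s 4 x = x + x + x + x"
  using scale_left_distrib[of 2 2 x] by (simp add: scale_two)

lemma add_self_eq_0: "x + x = 0 \<longleftrightarrow> x = 0" for x :: 'g
  using scale_eq_0_iff[of 2 x] by (simp add: scale_two)

lemma h_gr_minus: "x \<in> gr (-1) \<Longrightarrow> br (br e f) x = - (x + x)"
  and h_gr_zero: "x \<in> gr 0 \<Longrightarrow> br (br e f) x = 0"
  and h_gr_one: "x \<in> gr 1 \<Longrightarrow> br (br e f) x = x + x"
  using h_gr[of x "-1"] h_gr[of x 0] h_gr[of x 1] by (auto simp: scale_two)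

lemma gr_decomp: "\<exists>a\<in>gr (-1). \<exists>w\<in>gr 0. \<exists>z\<in>gr 1. x = a + w + z"
proof -
  obtain c where c: "\<forall>i. c i \<in> gr i" "finite {i. c i \<noteq> 0}" "x = (\<Sum>i | c i \<noteq> 0. c i)"
    using short unfolding short_grading_def Z_grading_def by metis
  have "{i. c i \<noteq> 0} \<subseteq> {-1, 0, 1}" using c(1) gr_trivial by blast
  then have "x = (\<Sum>i\<in>{-1, 0, 1}. c i)"
    unfolding c(3) by (intro sum.mono_neutral_left) auto
  then have "x = c (-1) + c 0 + c 1" by (simp add: add.assoc)
  then show ?thesis using c(1) by blast
qed

text \<open>As \<open>\<gg>(-2)\<close> and \<open>\<gg>(2)\<close> vanish, \<open>f\<close> kills \<open>\<gg>(-1)\<close> and \<open>e\<close> kills \<open>\<gg>(1)\<close>; hence on these two spaces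
  \<open>ad f \<circ> ad e\<close> and \<open>ad e \<circ> ad f\<close> reduce to \<open>-ad h\<close> and \<open>ad h\<close>.\<close>

lemma f_e_gr_minus: assumes "a \<in> gr (-1)" shows "br f (br e a) = a + a"
proof -
  have "br f a = 0" by (rule gr_trivial[OF br_gr[OF f_gr assms refl]]) simp
  then have "br f (br e a) = - br (br e f) a"
    using br_leibniz[of e f a] by (simp add: br_zero_right eq_neg_iff_add_eq_0 add.commute)
  then show ?thesis by (simp add: h_gr_minus[OF assms])
qed

lemma e_f_gr_one: assumes "z \<in> gr 1" shows "br e (br f z) = z + z"
proof -
  have "br e z = 0" by (rule gr_trivial[OF br_gr[OF e_gr assms refl]]) simp
  then show ?thesis
    using br_leibniz[of e f z] h_gr_one[OF assms] by (simp add: br_bilinear)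
qed

lemma e_inj_gr_minus: assumes "a \<in> gr (-1)" "br e a = 0" shows "a = 0"
  using f_e_gr_minus[OF assms(1)] assms(2) by (simp add: br_bilinear add_self_eq_0)

lemma m_gr_zero: "y \<in> \<mm> br gr e \<Longrightarrow> y \<in> gr 0"
  unfolding \<mm>_def using br_gr[OF e_gr, of _ "-1" 0] by auto

lemma m_subspace: "subspace (\<mm> br gr e)"
proof -
  interpret r: Vector_Spaces.linear s s "br e" using linear_right by simp
  show ?thesis unfolding \<mm>_def by (rule r.subspace_image[OF gr_subspace])
qed

lemma e_f_m: assumes "y \<in> \<mm> br gr e" shows "br e (br f y) = y + y"
  using assms f_e_gr_minus by (auto simp: \<mm>_def br_bilinear)

lemma f_e_m: assumes "y \<in> \<mm> br gr e" shows "br f (br e y) = y + y"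
  using br_leibniz[of e f y] h_gr_zero[OF m_gr_zero[OF assms]] e_f_m[OF assms] by simp

lemma gr_minus_eq: assumes "a \<in> gr (-1)" shows "\<exists>y\<in>\<mm> br gr e. a = br y f"
proof
  have "br e a \<in> \<mm> br gr e" using assms by (simp add: \<mm>_def)
  then show "- s (1 / 2) (br e a) \<in> \<mm> br gr e"
    by (intro subspace_neg subspace_scale m_subspace)
  have "br (- s (1 / 2) (br e a)) f = - s (1 / 2) (- br f (br e a))"
    unfolding br_minus_left br_scale_left by (subst br_skew) (rule refl)
  also have "\<dots> = a" by (simp add: f_e_gr_minus[OF assms] flip: scale_two)
  finally show "a = br (- s (1 / 2) (br e a)) f" ..
qed

text \<open>This makes \<open>(ad e)\<^sup>2\<close> map \<open>\<gg>(-1)\<close> onto \<open>\<gg>(1)\<close>, with the preimage of \<open>z\<close> in closed form; it is the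
  reason why \<open>\<gg>(1)\<close> is already \<open>[\<mm>, e]\<close> and why \<open>\<mm>\<close> together with the kernel \<open>\<kk>\<close> of \<open>ad e\<close> spans \<open>\<gg>(0)\<close>.\<close>

lemma gr_one_eq_ad_e_squared: assumes "z \<in> gr 1"
  shows "br e (br e (br f (br f z))) = s 4 z"
proof -
  have fz: "br f z \<in> gr 0" by (rule br_gr[OF f_gr assms]) simp
  have "br e (br f (br f z)) = br f z + br f z"
    using br_leibniz[of e f "br f z"] h_gr_zero[OF fz] e_f_gr_one[OF assms]
    by (simp add: br_bilinear)
  then show ?thesis using e_f_gr_one[OF assms] by (simp add: br_bilinear scale_four add.assoc)
qed

lemma gr_one_eq: assumes "z \<in> gr 1" shows "\<exists>y\<in>\<mm> br gr e. z = br y e"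
proof
  have "br f (br f z) \<in> gr (-1)"
    by (rule br_gr[OF f_gr br_gr[OF f_gr assms refl]]) simp
  then have "br e (br f (br f z)) \<in> \<mm> br gr e" by (simp add: \<mm>_def)
  then show "- s (1 / 4) (br e (br f (br f z))) \<in> \<mm> br gr e"
    by (intro subspace_neg subspace_scale m_subspace)
  have "br (- s (1 / 4) (br e (br f (br f z)))) e = - s (1 / 4) (- br e (br e (br f (br f z))))"
    unfolding br_minus_left br_scale_left by (subst br_skew) (rule refl)
  also have "\<dots> = z" by (simp add: gr_one_eq_ad_e_squared[OF assms])
  finally show "z = br (- s (1 / 4) (br e (br f (br f z)))) e" ..
qed

lemma gr_zero_decomp: assumes "w \<in> gr 0"
  shows "\<exists>x\<in>\<kk> br gr e. \<exists>y\<in>\<mm> br gr e. w = x + y"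
proof -
  have ew: "br e w \<in> gr 1" by (rule br_gr[OF e_gr assms]) simp
  obtain y where y: "y \<in> \<mm> br gr e" "br e w = br y e" using gr_one_eq[OF ew] by blast
  have "br e (w + y) = 0" using y br_skew[of y e] by (simp add: br_bilinear)
  moreover have "w + y \<in> gr 0"
    using assms m_gr_zero[OF y(1)] gr_subspace by (auto intro: subspace_add)
  moreover have "w = (w + y) + (- y)" by simp
  ultimately show ?thesis
    using subspace_neg[OF m_subspace y(1)]
    by (intro bexI[of _ "w + y"] bexI[of _ "- y"]) (auto simp: \<kk>_def)
qed

text \<open>The two summands have degrees \<open>1\<close> and \<open>-1\<close>, so both vanish; \<open>ad e\<close> and \<open>ad f\<close> are injective on
  \<open>\<mm>\<close> because composing them there is multiplication by \<open>2\<close>.\<close>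

lemma m_e_plus_m_f_eq_0:
  assumes y: "y \<in> \<mm> br gr e" "y' \<in> \<mm> br gr e" and sum: "br y e + br y' f = 0"
  shows "y = 0" "y' = 0"
proof -
  have 1: "br y e \<in> gr 1" and 2: "br y' f \<in> gr (-1)"
    using br_gr[OF m_gr_zero[OF y(1)] e_gr] br_gr[OF m_gr_zero[OF y(2)] f_gr] by auto
  have eq: "br y e = - br y' f" using sum by (simp add: eq_neg_iff_add_eq_0)
  (* Applying \<open>ad h\<close> separates the two degrees. *)
  have "br (br e f) (br y e) = - br (br e f) (br y' f)" by (simp add: eq br_bilinear)
  then have "br y e + br y e = br y' f + br y' f" using h_gr_one[OF 1] h_gr_minus[OF 2] by simp
  then have "(br y e + br y e) + (br y e + br y e) = (br y' f + br y' f) + (br y e + br y e)"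
    by (simp only:)
  also have "\<dots> = 0" by (simp add: eq)
  finally have "(br y e + br y e) + (br y e + br y e) = 0" .
  then have ye: "br y e = 0" unfolding add_self_eq_0 .
  then have yf: "br y' f = 0" using sum by simp
  show "y = 0" using f_e_m[OF y(1)] br_skew[of e y] ye by (simp add: br_bilinear add_self_eq_0)
  show "y' = 0" using e_f_m[OF y(2)] br_skew[of f y'] yf by (simp add: br_bilinear add_self_eq_0)
qed

text \<open>The Leibniz rule for \<open>ad e\<close>, symmetrised: adding the expansions of \<open>[e, a \<circ> b]\<close> and
  \<open>[e, b \<circ> a]\<close>, which agree because \<open>[a, b] \<in> \<gg>(-2)\<close> vanishes, cancels \<open>[[e, a], [e, b]]\<close>.\<close>

lemma e_jordan_product:
  assumes a: "a \<in> gr (-1)" and b: "b \<in> gr (-1)"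
  shows "br e (jordan_product br e a b) + br e (jordan_product br e a b)
    = br a (br e (br e b)) + br b (br e (br e a))"
proof -
  have "br a b = 0" by (rule gr_trivial[OF br_gr[OF a b refl]]) simp
  then have comm: "br a (br e b) = br b (br e a)"
    using br_leibniz[of e a b] br_skew[of "br e a" b] by (simp add: br_bilinear)
  have "br e (br a (br e b)) = br (br e a) (br e b) + br a (br e (br e b))"
    by (rule br_leibniz)
  moreover have "br e (br b (br e a)) = br (br e b) (br e a) + br b (br e (br e a))"
    by (rule br_leibniz)
  ultimately have "br e (br a (br e b)) + br e (br b (br e a))
      = br a (br e (br e b)) + br b (br e (br e a))"
    using br_skew[of "br e b" "br e a"] by simp
  then show ?thesis by (simp add: jordan_product_def comm)
qed

lemma ad_m_expand: assumes "a \<in> gr (-1)"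
  shows "br (br e a) (e - f) = a + a - br e (br e a)"
    and "br (br e a) (e + f) = - (a + a) - br e (br e a)"
  using br_skew[of "br e a" e] br_skew[of "br e a" f] f_e_gr_minus[OF assms]
  by (simp_all add: br_bilinear)

text \<open>The element \<open>a \<circ> b\<close> lies in \<open>\<gg>(-1)\<close>, where \<open>ad e\<close> is injective, so this identity matches the
  zero set of the commutator with that of the Jordan product.\<close>

lemma commutator_eq_jordan_product:
  assumes a: "a \<in> gr (-1)" and b: "b \<in> gr (-1)"
  shows "br (br (br e a) (e - f)) (br (br e b) (e + f))
    = s (-4) (br e (jordan_product br e a b))"
proof -
  have gr1: "br e (br e x) \<in> gr 1" if "x \<in> gr (-1)" for x
    by (rule br_gr[OF e_gr br_gr[OF e_gr that refl]]) simp
  have ab: "br a b = 0" by (rule gr_trivial[OF br_gr[OF a b refl]]) simp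
  have eeab: "br (br e (br e a)) (br e (br e b)) = 0"
    by (rule gr_trivial[OF br_gr[OF gr1[OF a] gr1[OF b] refl]]) simp
  have "br (br (br e a) (e - f)) (br (br e b) (e + f))
      = - (br a (br e (br e b)) + br b (br e (br e a)))
        - (br a (br e (br e b)) + br b (br e (br e a)))"
    unfolding ad_m_expand[OF a] ad_m_expand[OF b]
    using ab eeab br_skew[of "br e (br e a)" b] by (simp add: br_bilinear algebra_simps)
  also have "\<dots> = - s 4 (br e (jordan_product br e a b))"
    unfolding e_jordan_product[OF a b, symmetric] by (simp add: scale_four algebra_simps)
  finally show ?thesis by simp
qed

lemma commutator_eq_0_iff:
  assumes "a \<in> gr (-1)" "b \<in> gr (-1)"
  shows "br (br (br e a) (e - f)) (br (br e b) (e + f)) = 0 \<longleftrightarrow> jordan_product br e a b = 0"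
proof -
  have "jordan_product br e a b \<in> gr (-1)"
    unfolding jordan_product_def by (rule br_gr[OF assms(1) br_gr[OF e_gr assms(2) refl]]) simp
  then show ?thesis
    unfolding commutator_eq_jordan_product[OF assms]
    using e_inj_gr_minus by (auto simp: br_bilinear)
qed

text \<open>Applying \<open>ad e\<close> to \<open>\<plusminus>2a - [e, [e, a]]\<close> kills the component in \<open>\<gg>(1)\<close>, and \<open>ad f\<close> then recovers \<open>\<plusminus>4a\<close>.
  The left inverse obtained in this way is defined and linear on all of \<open>\<gg>\<close>.\<close>

lemma ad_m_inverse: assumes "a \<in> gr (-1)"
  shows "s (1 / 4) (br f (br e (br (br e a) (e - f)))) = a"
    and "- s (1 / 4) (br f (br e (br (br e a) (e + f)))) = a"
proof -
  have "br e (br e (br e a)) = 0"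
    by (rule gr_trivial[OF br_gr[OF e_gr br_gr[OF e_gr br_gr[OF e_gr assms refl] refl] refl]]) simp
  then have "br f (br e (br (br e a) (e - f))) = s 4 a"
    and "br f (br e (br (br e a) (e + f))) = - s 4 a"
    unfolding ad_m_expand[OF assms]
    using f_e_gr_minus[OF assms] by (simp_all add: br_bilinear scale_four add.assoc)
  then show "s (1 / 4) (br f (br e (br (br e a) (e - f)))) = a"
    "- s (1 / 4) (br f (br e (br (br e a) (e + f)))) = a" by simp_all
qed

end

section \<open>Eigenspaces of the Jordan triad\<close>

context short_graded_sl2
begin

context
  fixes \<sigma>1 \<sigma>2 \<sigma>3
  assumes triad: "jordan_triad s br gr e f \<sigma>1 \<sigma>2 \<sigma>3"
begin

lemma sigma_linear: "Vector_Spaces.linear s s \<sigma>1" "Vector_Spaces.linear s s \<sigma>2"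
  using triad by (auto simp: jordan_triad_def lie_involution_def)

lemma sigma_br: "\<sigma>1 (br x y) = br (\<sigma>1 x) (\<sigma>1 y)" "\<sigma>2 (br x y) = br (\<sigma>2 x) (\<sigma>2 y)"
  using triad by (auto simp: jordan_triad_def lie_involution_def)

lemma sigma_add: "\<sigma>1 (x + y) = \<sigma>1 x + \<sigma>1 y" "\<sigma>2 (x + y) = \<sigma>2 x + \<sigma>2 y"
proof -
  interpret s1: Vector_Spaces.linear s s \<sigma>1 by (rule sigma_linear)
  interpret s2: Vector_Spaces.linear s s \<sigma>2 by (rule sigma_linear)
  show "\<sigma>1 (x + y) = \<sigma>1 x + \<sigma>1 y" "\<sigma>2 (x + y) = \<sigma>2 x + \<sigma>2 y"
    by (rule s1.add s2.add)+
qed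

lemma sigma1_gr: "x \<in> gr 0 \<Longrightarrow> \<sigma>1 x = x" "x \<in> gr (-1) \<Longrightarrow> \<sigma>1 x = - x" "x \<in> gr 1 \<Longrightarrow> \<sigma>1 x = - x"
  using triad by (auto simp: jordan_triad_def)

lemma sigma2_k: "x \<in> \<kk> br gr e \<Longrightarrow> \<sigma>2 x = x"
  and sigma2_m: "x \<in> \<mm> br gr e \<Longrightarrow> \<sigma>2 x = - x"
  and sigma2_e_f: "\<sigma>2 e = f" "\<sigma>2 f = e"
  using triad by (auto simp: jordan_triad_def)

lemma sigma2_m_e_plus_m_f:
  assumes "y \<in> \<mm> br gr e" "y' \<in> \<mm> br gr e"
  shows "\<sigma>2 (br y e + br y' f) = - br y' e - br y f"
  using assms by (simp add: sigma_add sigma_br sigma2_m sigma2_e_f br_bilinear)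

lemma sigma1_eq_self_iff: "\<sigma>1 x = x \<longleftrightarrow> x \<in> gr 0"
proof
  assume x: "\<sigma>1 x = x"
  obtain a w z where d: "a \<in> gr (-1)" "w \<in> gr 0" "z \<in> gr 1" "x = a + w + z"
    using gr_decomp[of x] by blast
  have sx: "\<sigma>1 x = - a + w - z" using d by (simp add: sigma_add sigma1_gr)
  have "(a + z) + (a + z) = x - \<sigma>1 x" unfolding sx by (simp add: d(4) algebra_simps)
  then have "a + z = 0" using x add_self_eq_0 by simp
  moreover have "x = w + (a + z)" by (simp add: d(4) algebra_simps)
  ultimately have "x = w" by simp
  then show "x \<in> gr 0" using d(2) by simp
qed (rule sigma1_gr)

lemma sigma1_eq_minus_iff:
  "\<sigma>1 x = - x \<longleftrightarrow> (\<exists>y\<in>\<mm> br gr e. \<exists>y'\<in>\<mm> br gr e. x = br y e + br y' f)"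
proof
  assume x: "\<sigma>1 x = - x"
  obtain a w z where d: "a \<in> gr (-1)" "w \<in> gr 0" "z \<in> gr 1" "x = a + w + z"
    using gr_decomp[of x] by blast
  have sx: "\<sigma>1 x = - a + w - z" using d by (simp add: sigma_add sigma1_gr)
  have "w + w = x + \<sigma>1 x" unfolding sx by (simp add: d(4) algebra_simps)
  then have "w + w = 0" using x by simp
  then have "x = z + a" using add_self_eq_0[of w] d(4) by (simp add: algebra_simps)
  then show "\<exists>y\<in>\<mm> br gr e. \<exists>y'\<in>\<mm> br gr e. x = br y e + br y' f"
    using gr_one_eq[OF d(3)] gr_minus_eq[OF d(1)] by blast
next
  assume "\<exists>y\<in>\<mm> br gr e. \<exists>y'\<in>\<mm> br gr e. x = br y e + br y' f"
  then obtain y y' where y: "y \<in> \<mm> br gr e" "y' \<in> \<mm> br gr e" "x = br y e + br y' f" by blast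
  have "br y e \<in> gr 1" "br y' f \<in> gr (-1)"
    using br_gr[OF m_gr_zero[OF y(1)] e_gr] br_gr[OF m_gr_zero[OF y(2)] f_gr] by auto
  then show "\<sigma>1 x = - x" by (simp add: y(3) sigma_add sigma1_gr)
qed

text \<open>On the \<open>-1\<close>-eigenspace of \<open>\<sigma>\<^sub>1\<close> the representation \<open>[y, e] + [y', f]\<close> is unique, so an eigenvector
  of \<open>\<sigma>\<^sub>2\<close> for the eigenvalue \<open>1\<close> has \<open>y' = -y\<close>, and one for the eigenvalue \<open>-1\<close> has \<open>y' = y\<close>.\<close>

lemma eigenspace_10: "joint_eigenspace s \<sigma>1 \<sigma>2 1 0 = (\<lambda>x. br x (e - f)) ` \<mm> br gr e"
proof (intro equalityI subsetI)
  fix x assume "x \<in> joint_eigenspace s \<sigma>1 \<sigma>2 1 0"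
  then have x: "\<sigma>1 x = - x" "\<sigma>2 x = x" by (auto simp: joint_eigenspace_def)
  then obtain y y' where y: "y \<in> \<mm> br gr e" "y' \<in> \<mm> br gr e" "x = br y e + br y' f"
    using sigma1_eq_minus_iff by blast
  have "br (y + y') e + br (y + y') f = x - \<sigma>2 x"
    unfolding y(3) sigma2_m_e_plus_m_f[OF y(1,2)] by (simp add: br_bilinear algebra_simps)
  then have "y + y' = 0"
    using x m_e_plus_m_f_eq_0(1)[of "y + y'" "y + y'"] subspace_add[OF m_subspace] y by simp
  then have "y' = - y" by (simp add: eq_neg_iff_add_eq_0 add.commute)
  then have "x = br y (e - f)" by (simp add: y(3) br_bilinear)
  then show "x \<in> (\<lambda>x. br x (e - f)) ` \<mm> br gr e" using y by blast
next
  fix x assume "x \<in> (\<lambda>x. br x (e - f)) ` \<mm> br gr e"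
  then obtain y where y: "y \<in> \<mm> br gr e" "x = br y e + br (- y) f" by (auto simp: br_bilinear)
  have y': "- y \<in> \<mm> br gr e" by (rule subspace_neg[OF m_subspace y(1)])
  have "\<sigma>1 x = - x" using sigma1_eq_minus_iff y y' by blast
  moreover have "\<sigma>2 x = x"
    unfolding y(2) sigma2_m_e_plus_m_f[OF y(1) y'] by (simp add: br_bilinear)
  ultimately show "x \<in> joint_eigenspace s \<sigma>1 \<sigma>2 1 0" by (simp add: joint_eigenspace_def)
qed

lemma eigenspace_11: "joint_eigenspace s \<sigma>1 \<sigma>2 1 1 = (\<lambda>x. br x (e + f)) ` \<mm> br gr e"
proof (intro equalityI subsetI)
  fix x assume "x \<in> joint_eigenspace s \<sigma>1 \<sigma>2 1 1"
  then have x: "\<sigma>1 x = - x" "\<sigma>2 x = - x" by (auto simp: joint_eigenspace_def)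
  then obtain y y' where y: "y \<in> \<mm> br gr e" "y' \<in> \<mm> br gr e" "x = br y e + br y' f"
    using sigma1_eq_minus_iff by blast
  have "br (y - y') e + br (y' - y) f = x + \<sigma>2 x"
    unfolding y(3) sigma2_m_e_plus_m_f[OF y(1,2)] by (simp add: br_bilinear algebra_simps)
  then have "y - y' = 0"
    using x m_e_plus_m_f_eq_0(1)[of "y - y'" "y' - y"] subspace_diff[OF m_subspace] y by simp
  then have "x = br y (e + f)" by (simp add: y(3) br_bilinear)
  then show "x \<in> (\<lambda>x. br x (e + f)) ` \<mm> br gr e" using y by blast
next
  fix x assume "x \<in> (\<lambda>x. br x (e + f)) ` \<mm> br gr e"
  then obtain y where y: "y \<in> \<mm> br gr e" "x = br y e + br y f" by (auto simp: br_bilinear)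
  have "\<sigma>1 x = - x" using sigma1_eq_minus_iff y by blast
  moreover have "\<sigma>2 x = - x"
    unfolding y(2) sigma2_m_e_plus_m_f[OF y(1) y(1)] by simp
  ultimately show "x \<in> joint_eigenspace s \<sigma>1 \<sigma>2 1 1" by (simp add: joint_eigenspace_def)
qed

lemma eigenspace_01: "joint_eigenspace s \<sigma>1 \<sigma>2 0 1 = \<mm> br gr e"
proof (intro equalityI subsetI)
  fix w assume "w \<in> joint_eigenspace s \<sigma>1 \<sigma>2 0 1"
  then have w: "w \<in> gr 0" "\<sigma>2 w = - w" by (auto simp: joint_eigenspace_def sigma1_eq_self_iff)
  obtain x y where xy: "x \<in> \<kk> br gr e" "y \<in> \<mm> br gr e" "w = x + y"
    using gr_zero_decomp[OF w(1)] by blast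
  (* \<open>\<sigma>2 w = x - y\<close>, so the \<open>\<kk>\<close>-component \<open>x\<close> of \<open>w\<close> vanishes. *)
  have "x + x = w + \<sigma>2 w" using xy by (simp add: sigma_add sigma2_k sigma2_m algebra_simps)
  then have "x + x = 0" using w(2) by simp
  then show "w \<in> \<mm> br gr e" using xy add_self_eq_0 by simp
next
  fix y assume "y \<in> \<mm> br gr e"
  then show "y \<in> joint_eigenspace s \<sigma>1 \<sigma>2 0 1"
    by (simp add: joint_eigenspace_def sigma1_eq_self_iff m_gr_zero sigma2_m)
qed

lemma br_eigenspaces:
  assumes "u \<in> joint_eigenspace s \<sigma>1 \<sigma>2 1 0" "v \<in> joint_eigenspace s \<sigma>1 \<sigma>2 1 1"
  shows "br u v \<in> joint_eigenspace s \<sigma>1 \<sigma>2 0 1"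
  using assms by (simp add: joint_eigenspace_def sigma_br br_bilinear)

section \<open>The commuting variety of the Jordan algebra\<close>

lemma isomorphic_commuting_variety:
  assumes fd: "finite_dimensional_vector_space s B"
  shows "isomorphic_varieties (module_prod.scale s s) (module_prod.scale s s)
     (jordan_commuting_variety br gr e)
     {(u, v) \<in> joint_eigenspace s \<sigma>1 \<sigma>2 1 0 \<times> joint_eigenspace s \<sigma>1 \<sigma>2 1 1. br u v = 0}"
    (is "isomorphic_varieties ?S ?S ?X ?Y")
proof -
  interpret pr: vector_space_prod s s ..
  note linear_comp = Vector_Spaces.linear_compose[unfolded comp_def]
  define F where "F = (\<lambda>z. (br (br e (fst z)) (e - f), br (br e (snd z)) (e + f)))"
  define H where "H = (\<lambda>z. (s (1 / 4) (br f (br e (fst z))), - s (1 / 4) (br f (br e (snd z)))))"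
  have X_closed: "closedin (zariski ?S) ?X"
  proof -
    have eq: "?X = {z. br (br e f) (fst z) = s (of_int (2 * -1)) (fst z)}
        \<inter> {z. br (br e f) (snd z) = s (of_int (2 * -1)) (snd z)}
        \<inter> {z. br (fst z) (br e (snd z)) = 0}"
      using h_grading
      by (auto simp: jordan_commuting_variety_def jordan_product_def grading_element_def)
    have "polynomial_map ?S s (\<lambda>z. br (fst z) (br e (snd z)))"
      by (rule bilinear_polynomial_map[OF fd])
        (auto intro: linear_left linear_comp[OF linear_right linear_right])
    note zeros = closedin_polynomial_map_zeros[OF fd this]
    show ?thesis
      unfolding eq
      by (intro closedin_Int zeros closedin_eigenspace_factor[OF fd linear_right, of "br e f"])
  qed
  have Y_closed: "closedin (zariski ?S) ?Y"
  proof -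
    have eq: "?Y = {z. \<sigma>1 (fst z) = s ((-1)^1) (fst z)} \<inter> {z. \<sigma>2 (fst z) = s ((-1)^0) (fst z)}
        \<inter> ({z. \<sigma>1 (snd z) = s ((-1)^1) (snd z)} \<inter> {z. \<sigma>2 (snd z) = s ((-1)^1) (snd z)})
        \<inter> {z. br (fst z) (snd z) = 0}"
      by (auto simp: joint_eigenspace_def)
    have "polynomial_map ?S s (\<lambda>z. br (fst z) (snd z))"
      by (rule bilinear_polynomial_map[OF fd linear_left linear_right])
    note zeros = closedin_polynomial_map_zeros[OF fd this]
    show ?thesis
      unfolding eq
      by (intro closedin_Int zeros closedin_eigenspace_factor[OF fd sigma_linear(1)]
          closedin_eigenspace_factor[OF fd sigma_linear(2)])
  qed
  have F: "polynomial_map ?S ?S F" and H: "polynomial_map ?S ?S H"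
    unfolding F_def H_def
    by (rule linear_polynomial_map, unfold_locales,
        auto simp: pr.scale_def br_bilinear scale_right_distrib scale_right_diff_distrib mult.commute)+
  have FXY: "F \<in> ?X \<rightarrow> ?Y"
    unfolding F_def eigenspace_10 eigenspace_11 \<mm>_def
    by (auto simp add: jordan_commuting_variety_def commutator_eq_0_iff)
  have HF: "\<forall>x\<in>?X. H (F x) = x"
    using ad_m_inverse by (auto simp: F_def H_def jordan_commuting_variety_def)
  have FX: "\<exists>x\<in>?X. y = F x" if "y \<in> ?Y" for y
  proof -
    obtain u v where uv: "y = (u, v)" "br u v = 0"
      "u \<in> (\<lambda>x. br x (e - f)) ` br e ` gr (-1)" "v \<in> (\<lambda>x. br x (e + f)) ` br e ` gr (-1)"
      using \<open>y \<in> ?Y\<close> unfolding eigenspace_10 eigenspace_11 \<mm>_def by blast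
    then obtain a b where ab: "a \<in> gr (-1)" "b \<in> gr (-1)"
      "u = br (br e a) (e - f)" "v = br (br e b) (e + f)"
      by blast
    have "jordan_product br e a b = 0"
      using uv(2) commutator_eq_0_iff[OF ab(1,2)] unfolding ab(3,4) by blast
    then have "(a, b) \<in> ?X" using ab(1,2) by (simp add: jordan_commuting_variety_def)
    moreover have "y = F (a, b)" by (simp add: F_def uv(1) ab(3,4))
    ultimately show ?thesis by blast
  qed
  have FH: "H y \<in> ?X \<and> F (H y) = y" if "y \<in> ?Y" for y
    using FX[OF that] HF by metis
  have "affine_morphism ?S ?S ?X ?Y F" using F FXY by (rule polynomial_map_affine_morphism)
  moreover have "affine_morphism ?S ?S ?Y ?X H"
    using H by (rule polynomial_map_affine_morphism) (use FH in blast)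
  moreover have "\<forall>y\<in>?Y. F (H y) = y" using FH by blast
  ultimately show ?thesis unfolding isomorphic_varieties_def using X_closed Y_closed HF by blast
qed

end

end

theorem theorem6p3:
  fixes s :: "'k::{alg_closed_field, field_char_0} \<Rightarrow> 'g::ab_group_add \<Rightarrow> 'g"
    and br :: "'g \<Rightarrow> 'g \<Rightarrow> 'g"
    and G G0 :: "('k^'n^'n) set"
    and \<theta> :: "'g \<Rightarrow> 'k^'n^'n"
    and gr :: "int \<Rightarrow> 'g set"
    and e f h :: 'g
    and \<sigma>1 \<sigma>2 \<sigma>3 :: "'g \<Rightarrow> 'g"
  assumes simple: "simple_lie_algebra s br"
    and G: "connected_algebraic_group G" "lie_algebra_of_group s br G \<theta>"
    and grading: "short_grading s br gr"
    and h: "grading_element s br gr h"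
    and G0: "connected_algebraic_group G0" "G0 \<subseteq> G" "Lie G0 = \<theta> ` gr 0"
    and dense_orbit: "e \<in> gr 1" "zariski s closure_of ((\<lambda>A. Ad \<theta> A e) ` G0) = gr 1"
    and reductive: "reductive_group {A \<in> G0. Ad \<theta> A e = e}"
    and f: "f \<in> gr (-1)" "br e f = h"
    and triad: "jordan_triad s br gr e f \<sigma>1 \<sigma>2 \<sigma>3"
  shows "joint_eigenspace s \<sigma>1 \<sigma>2 1 0 = (\<lambda>x. br x (e - f)) ` \<mm> br gr e \<and>
    joint_eigenspace s \<sigma>1 \<sigma>2 1 1 = (\<lambda>x. br x (e + f)) ` \<mm> br gr e \<and>
    joint_eigenspace s \<sigma>1 \<sigma>2 0 1 = \<mm> br gr e \<and>
    (\<lambda>(u, v). br u v) \<in> joint_eigenspace s \<sigma>1 \<sigma>2 1 0 \<times> joint_eigenspace s \<sigma>1 \<sigma>2 1 1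
           \<rightarrow> joint_eigenspace s \<sigma>1 \<sigma>2 0 1 \<and>
    isomorphic_varieties (module_prod.scale s s) (module_prod.scale s s)
           (jordan_commuting_variety br gr e)
           {(u, v) \<in> joint_eigenspace s \<sigma>1 \<sigma>2 1 0 \<times> joint_eigenspace s \<sigma>1 \<sigma>2 1 1. br u v = 0}"
proof -
  obtain B where fd: "finite_dimensional_vector_space s B"
    using simple by (auto simp: simple_lie_algebra_def)
  have "lie_algebra s br" using simple unfolding simple_lie_algebra_def by blast
  moreover have "grading_element s br gr (br e f)" unfolding f(2) by (rule h)
  ultimately interpret short_graded_sl2 s br gr e f
    using grading dense_orbit(1) f(1)
    by (intro short_graded_sl2.intro short_graded_sl2_axioms.intro)
  have "(\<lambda>(u, v). br u v) \<in> joint_eigenspace s \<sigma>1 \<sigma>2 1 0 \<times> joint_eigenspace s \<sigma>1 \<sigma>2 1 1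
      \<rightarrow> joint_eigenspace s \<sigma>1 \<sigma>2 0 1"
    using br_eigenspaces[OF triad] by fast
  then show ?thesis
    by (intro conjI eigenspace_10[OF triad] eigenspace_11[OF triad] eigenspace_01[OF triad]
        isomorphic_commuting_variety[OF triad fd])
qed

end
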